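(* Let $X$ be a regular curve and let $f:X\to X$ be a homeomorphism with at least one wandering point. Then, for every integer $n\geq 1$, $h_{\mathrm{pol}}(F_n(f))=n$.
   Context: A continuum is a nonempty connected compact metric space. A continuum $X$ is a regular curve if for each $x\in X$ and each open neighbourhood $U$ of $x$ in $X$ there exists an open neighbourhood $V$ of $x$ in $X$ such that $V\subset U$ and the boundary $\partial V$ is finite. Polynomial entropy: let $(Y,d)$ be a compact metric space and $g:Y\to Y$ continuous. For $m\geq 1$ put $d_m^g(x,y)=\max_{0\leq k\leq m-1}d(g^k(x),g^k(y))$. For $\varepsilon>0$, a finite set $E\subset Y$ is $(m,\varepsilon)$-separated if $d_m^g(x,y)\geq\varepsilon$ for all distinct $x,y\in E$; $\mathrm{sep}(m,\varepsilon)$ denotes the maximal cardinality of an $(m,\varepsilon)$-separated subset of $Y$. Then $$h_{\mathrm{pol}}(g)=\lim_{\varepsilon\to 0}\limsup_{m\to\infty}\frac{\log \mathrm{sep}(m,\varepsilon)}{\log m}.$$ A set $A\subset X$ is wandering (for $f$) if $f^k(A)\cap A=\emptyset$ for all $k\geq 1$. A point $p\in X$ is wandering if it has a wandering neighbourhood $U\ni p$. For a compact metric space $X$ and $n\geq 1$, the $n$-fold symmetric product $F_n(X)$ is the set of all nonempty subsets of $X$ of cardinality at most $n$, a compact metric space with the Hausdorff metric. The induced map $F_n(f):F_n(X)\to F_n(X)$ is $F_n(f)(A)=\{f(x)\mid x\in A\}$. *)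

theory Defs
  imports "HOL-Analysis.Analysis"
begin

definition continuum :: "'a::metric_space set \<Rightarrow> bool" where
  "continuum X \<longleftrightarrow> X \<noteq> {} \<and> connected X \<and> compact X"

(* All topological notions are relative to X; the boundary of V is taken in X. *)
definition regular_curve :: "'a::metric_space set \<Rightarrow> bool" where
  "regular_curve X \<longleftrightarrow> continuum X \<and>
     (\<forall>x\<in>X. \<forall>U. openin (top_of_set X) U \<and> x \<in> U \<longrightarrow>
        (\<exists>V. openin (top_of_set X) V \<and> x \<in> V \<and> V \<subseteq> U \<and>
             finite ((top_of_set X) frontier_of V)))"

definition wandering_set :: "('a \<Rightarrow> 'a) \<Rightarrow> 'a set \<Rightarrow> bool" where
  "wandering_set f A \<longleftrightarrow> (\<forall>k\<ge>1. (f ^^ k) ` A \<inter> A = {})"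

(* U is a neighbourhood of p in X, not necessarily open. *)
definition wandering_point :: "'a::metric_space set \<Rightarrow> ('a \<Rightarrow> 'a) \<Rightarrow> 'a \<Rightarrow> bool" where
  "wandering_point X f p \<longleftrightarrow>
     (\<exists>U\<subseteq>X. (\<exists>W. openin (top_of_set X) W \<and> p \<in> W \<and> W \<subseteq> U) \<and> wandering_set f U)"

(* The metric is an explicit argument d on the carrier Y, because the notions below
   are needed for the Hausdorff metric on a set of sets, which is no type class instance. *)
definition bowen_dist :: "('b \<Rightarrow> 'b \<Rightarrow> real) \<Rightarrow> ('b \<Rightarrow> 'b) \<Rightarrow> nat \<Rightarrow> 'b \<Rightarrow> 'b \<Rightarrow> real" where
  "bowen_dist d g m x y = Max ((\<lambda>k. d ((g ^^ k) x) ((g ^^ k) y)) ` {..<m})"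

definition separated_set ::
  "'b set \<Rightarrow> ('b \<Rightarrow> 'b \<Rightarrow> real) \<Rightarrow> ('b \<Rightarrow> 'b) \<Rightarrow> nat \<Rightarrow> real \<Rightarrow> 'b set \<Rightarrow> bool" where
  "separated_set Y d g m \<epsilon> E \<longleftrightarrow> finite E \<and> E \<subseteq> Y \<and>
     (\<forall>x\<in>E. \<forall>y\<in>E. x \<noteq> y \<longrightarrow> bowen_dist d g m x y \<ge> \<epsilon>)"

(* For m \<ge> 1, \<epsilon> > 0, (Y, d) compact and g continuous these cardinalities are bounded,
   so the maximum exists. *)
definition sep ::
  "'b set \<Rightarrow> ('b \<Rightarrow> 'b \<Rightarrow> real) \<Rightarrow> ('b \<Rightarrow> 'b) \<Rightarrow> nat \<Rightarrow> real \<Rightarrow> nat" where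
  "sep Y d g m \<epsilon> = Max {card E |E. separated_set Y d g m \<epsilon> E}"

(* The limit exists in the extended reals, the limsup being nonincreasing in \<epsilon>. *)
definition h_pol :: "'b set \<Rightarrow> ('b \<Rightarrow> 'b \<Rightarrow> real) \<Rightarrow> ('b \<Rightarrow> 'b) \<Rightarrow> ereal" where
  "h_pol Y d g =
     Lim (at_right 0) (\<lambda>\<epsilon>. limsup (\<lambda>m. ereal (ln (real (sep Y d g m \<epsilon>)) / ln (real m))))"

definition symmetric_product :: "nat \<Rightarrow> 'a set \<Rightarrow> 'a set set" where
  "symmetric_product n X = {A. A \<subseteq> X \<and> A \<noteq> {} \<and> finite A \<and> card A \<le> n}"

(* A metric on the nonempty compact sets; on other sets the value is meaningless. *)
definition hausdorff_dist :: "'a::metric_space set \<Rightarrow> 'a set \<Rightarrow> real" where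
  "hausdorff_dist A B = max (SUP a\<in>A. infdist a B) (SUP b\<in>B. infdist b A)"

definition induced_map :: "('a \<Rightarrow> 'a) \<Rightarrow> 'a set \<Rightarrow> 'a set" where
  "induced_map f A = {f x |x. x \<in> A}"

end

theory Submission
  imports Defs "HOL-Real_Asymp.Real_Asymp"
begin

text \<open>
  The value \<open>n\<close> is the common growth exponent of two polynomial bounds on the number of
  separated points of the induced map.

  Upper bound. A finite open cover of the curve by small sets with finite frontiers yields a
  finite set \<open>F\<close> containing all those frontiers. Given \<open>x\<close>, follow its orbit for \<open>m\<close> steps, pick
  a member \<open>V\<^sub>k\<close> of the cover around \<open>f\<^sup>k x\<close> for each \<open>k < m\<close>, and let \<open>W\<close> be the set of all
  points whose orbit stays in the same sets. The set \<open>W\<close> is open and small in the Bowen metric,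
  and its closure is small too. Since the curve is connected, \<open>W\<close> is everything or has a frontier point;
  a frontier point \<open>z\<close> satisfies \<open>f\<^sup>k z \<in> F\<close> for some \<open>k < m\<close>. As \<open>f\<close> is injective, there are at
  most \<open>m * card F\<close> such points, so the preimages of \<open>F\<close> span the dynamics up to time \<open>m\<close> with
  linearly many points (\<open>regular_curve_linear_spanning\<close>). Replacing every point of a set by a
  nearby spanning point shows that a separated family of at most \<open>n\<close>-element sets has at most
  \<open>(m * card F) ^ n\<close> members (\<open>card_separated_symmetric_product_le\<close>).

  Lower bound. The points \<open>f\<^bsup>-i\<^esup> p\<close> with \<open>i < m\<close> on the backward orbit of a wandering point
  \<open>p\<close> are separated: at time \<open>j\<close> the point with index \<open>j\<close> sits at \<open>p\<close>, while all the others
  are outside the wandering neighbourhood. Hence the \<open>m choose n\<close> many \<open>n\<close>-element sets of such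
  points are separated in the symmetric product (\<open>wandering_separated_family\<close>).
\<close>

section \<open>Separated sets and growth exponents\<close>

lemma bowen_dist_ge:
  assumes "k < m" "\<epsilon> \<le> d ((g ^^ k) x) ((g ^^ k) y)"
  shows "\<epsilon> \<le> bowen_dist d g m x y"
proof -
  have "d ((g ^^ k) x) ((g ^^ k) y) \<le> bowen_dist d g m x y"
    unfolding bowen_dist_def using assms(1) by (intro Max_ge) auto
  with assms(2) show ?thesis by simp
qed

lemma bowen_dist_le:
  assumes "m \<ge> 1" "\<And>k. k < m \<Longrightarrow> d ((g ^^ k) x) ((g ^^ k) y) \<le> r"
  shows "bowen_dist d g m x y \<le> r"
  unfolding bowen_dist_def
  using assms by (subst Max_le_iff) (auto simp: lessThan_empty_iff)

lemma sep_bounds: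
  assumes bound: "\<And>E. separated_set Y d g m \<epsilon> E \<Longrightarrow> card E \<le> K"
  shows "sep Y d g m \<epsilon> \<le> K"
    and "separated_set Y d g m \<epsilon> E \<Longrightarrow> card E \<le> sep Y d g m \<epsilon>"
proof -
  let ?S = "{card E |E. separated_set Y d g m \<epsilon> E}"
  have fin: "finite ?S"
    by (rule finite_subset[of _ "{..K}"]) (use bound in auto)
  have "separated_set Y d g m \<epsilon> {}"
    by (simp add: separated_set_def)
  then have "?S \<noteq> {}" by blast
  with fin show "sep Y d g m \<epsilon> \<le> K"
    unfolding sep_def using bound by (subst Max_le_iff) auto
  show "card E \<le> sep Y d g m \<epsilon>" if "separated_set Y d g m \<epsilon> E"
    unfolding sep_def using fin that by (intro Max_ge) auto
qed

lemma tendsto_growth_exponent: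
  fixes a :: "nat \<Rightarrow> nat"
  assumes "n \<ge> 1" "N \<ge> 1"
    and lower: "\<And>m. m \<ge> n \<Longrightarrow> (real m / real n) ^ n \<le> real (a m)"
    and upper: "\<And>m. m \<ge> 1 \<Longrightarrow> a m \<le> (m * N) ^ n"
  shows "(\<lambda>m. ln (real (a m)) / ln (real m)) \<longlonglongrightarrow> real n"
proof (rule tendsto_sandwich)
  have n: "real n > 0" and N: "real N > 0" using assms by auto
  show "(\<lambda>m. real n * (ln (real m) - ln (real n)) / ln (real m)) \<longlonglongrightarrow> real n"
    by real_asymp
  show "(\<lambda>m. real n * (ln (real m) + ln (real N)) / ln (real m)) \<longlonglongrightarrow> real n"
    by real_asymp
  show "\<forall>\<^sub>F m in sequentially.
      real n * (ln (real m) - ln (real n)) / ln (real m) \<le> ln (real (a m)) / ln (real m)"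
    using eventually_ge_at_top[of "max 2 n"]
  proof eventually_elim
    case (elim m)
    then have m: "real m > 0" "ln (real m) > 0" by auto
    have "real n * (ln (real m) - ln (real n)) = ln ((real m / real n) ^ n)"
      using m n by (simp add: ln_realpow ln_div)
    also have "\<dots> \<le> ln (real (a m))"
      using lower[of m] elim m n by (intro ln_mono) auto
    finally show ?case using m by (intro divide_right_mono) auto
  qed
  show "\<forall>\<^sub>F m in sequentially.
      ln (real (a m)) / ln (real m) \<le> real n * (ln (real m) + ln (real N)) / ln (real m)"
    using eventually_ge_at_top[of "max 2 n"]
  proof eventually_elim
    case (elim m)
    then have m: "real m > 0" "ln (real m) > 0" by auto
    have "0 < (real m / real n) ^ n" using m n by simp
    with lower[of m] elim have "0 < real (a m)" by linarith
    moreover have "real (a m) \<le> (real m * real N) ^ n"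
      using upper[of m] elim by (metis max.bounded_iff of_nat_le_iff of_nat_mult of_nat_power
          one_le_numeral order_trans)
    ultimately have "ln (real (a m)) \<le> ln ((real m * real N) ^ n)"
      by (intro ln_mono) auto
    also have "\<dots> = real n * (ln (real m) + ln (real N))"
      using m N by (simp add: ln_realpow ln_mult)
    finally show ?case using m by (intro divide_right_mono) auto
  qed
qed

section \<open>Homeomorphisms of regular curves span with linearly many points\<close>

lemma homeomorphism_funpow:
  assumes "homeomorphism X X f f'"
  shows "homeomorphism X X (f ^^ k) (f' ^^ k)"
proof (induction k)
  case 0
  show ?case by (simp add: homeomorphism_def id_def)
next
  case (Suc k)
  have "homeomorphism X X (f \<circ> f ^^ k) (f' ^^ k \<circ> f')"
    using homeomorphism_compose[OF Suc assms] .
  then show ?case by (simp only: funpow.simps(2)[of k f] funpow_Suc_right[of k f'])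
qed

lemma regular_curve_finite_frontier_cover:
  assumes "regular_curve X" "e > 0"
  obtains \<V> where "finite \<V>" "X \<subseteq> \<Union>\<V>"
    "\<And>V. V \<in> \<V> \<Longrightarrow> openin (top_of_set X) V"
    "\<And>V. V \<in> \<V> \<Longrightarrow> finite ((top_of_set X) frontier_of V)"
    "\<And>V x y. V \<in> \<V> \<Longrightarrow> x \<in> V \<Longrightarrow> y \<in> closure V \<Longrightarrow> dist x y \<le> e"
proof -
  have "compact X" using assms(1) by (simp add: regular_curve_def continuum_def)
  have small: "\<exists>V. openin (top_of_set X) V \<and> x \<in> V \<and> V \<subseteq> X \<inter> ball x (e/2) \<and>
      finite ((top_of_set X) frontier_of V)" if "x \<in> X" for x
  proof -
    have "openin (top_of_set X) (X \<inter> ball x (e/2)) \<and> x \<in> X \<inter> ball x (e/2)"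
      using that assms(2) by auto
    then show ?thesis
      using assms(1) that unfolding regular_curve_def by blast
  qed
  define \<C> where "\<C> = {V. openin (top_of_set X) V \<and> finite ((top_of_set X) frontier_of V) \<and>
      (\<exists>x. V \<subseteq> ball x (e/2))}"
  have "X \<subseteq> \<Union>\<C>"
  proof
    fix x assume "x \<in> X"
    from small[OF this] show "x \<in> \<Union>\<C>" unfolding \<C>_def by blast
  qed
  moreover have "\<forall>V\<in>\<C>. openin (top_of_set X) V" by (simp add: \<C>_def)
  ultimately obtain \<V> where \<V>: "\<V> \<subseteq> \<C>" "finite \<V>" "X \<subseteq> \<Union>\<V>"
    using \<open>compact X\<close> unfolding compact_eq_openin_cover by meson
  show thesis
  proof (rule that[OF \<V>(2,3)])
    fix V x y assume V: "V \<in> \<V>" "x \<in> V" "y \<in> closure V"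
    then obtain c where c: "V \<subseteq> ball c (e/2)" using \<V>(1) by (auto simp: \<C>_def)
    then have "closure V \<subseteq> cball c (e/2)"
      by (intro closure_minimal) (use ball_subset_cball in blast)+
    with V c have "dist c x < e/2" "dist c y \<le> e/2" by auto
    then show "dist x y \<le> e" using dist_triangle3[of x y c] by simp
  qed (use \<V>(1) in \<open>auto simp: \<C>_def\<close>)
qed

text \<open>
  The points whose orbits meet the frontiers before time \<open>m\<close> form the spanning set. They may cut
  the curve into infinitely many pieces, but each piece is approximated by a point on its
  frontier, so the pieces never have to be counted.
\<close>

lemma regular_curve_linear_spanning:
  fixes X :: "'a::metric_space set"
  assumes X: "regular_curve X" and f: "homeomorphism X X f f'" and e: "e > 0"
  obtains N where "N \<ge> 1"
    "\<And>m. m \<ge> 1 \<Longrightarrow> \<exists>P\<subseteq>X. finite P \<and> card P \<le> m * N \<and>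
       (\<forall>x\<in>X. \<exists>z\<in>P. \<forall>k<m. dist ((f ^^ k) x) ((f ^^ k) z) \<le> e)"
proof -
  obtain \<V> where \<V>: "finite \<V>" "X \<subseteq> \<Union>\<V>"
    and op: "\<And>V. V \<in> \<V> \<Longrightarrow> openin (top_of_set X) V"
    and fr: "\<And>V. V \<in> \<V> \<Longrightarrow> finite ((top_of_set X) frontier_of V)"
    and diam: "\<And>V x y. V \<in> \<V> \<Longrightarrow> x \<in> V \<Longrightarrow> y \<in> closure V \<Longrightarrow> dist x y \<le> e"
    by (rule regular_curve_finite_frontier_cover[OF X e]) blast
  have conn: "connected X" and ne: "X \<noteq> {}"
    using X by (auto simp: regular_curve_def continuum_def)
  obtain x0 where x0: "x0 \<in> X" using ne by blast
  \<comment> \<open>An extra point keeps \<open>F\<close> nonempty when the cover has no frontier points at all.\<close>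
  define F where "F = insert x0 (\<Union>V\<in>\<V>. (top_of_set X) frontier_of V)"
  have F: "finite F" "F \<subseteq> X" "x0 \<in> F"
    using \<V>(1) fr x0 frontier_of_subset_topspace[of "top_of_set X"] by (auto simp: F_def)
  have fk: "homeomorphism X X (f ^^ k) (f' ^^ k)" for k
    using homeomorphism_funpow[OF f] .
  show thesis
  proof (rule that[of "card F"])
    show "card F \<ge> 1" using F by (metis One_nat_def Suc_leI card_gt_0_iff empty_iff)
    fix m :: nat assume m: "m \<ge> 1"
    define P where "P = (\<Union>k<m. (f' ^^ k) ` F)"
    have "P \<subseteq> X"
      using F(2) fk unfolding P_def homeomorphism_def by blast
    moreover have "finite P" using F(1) by (simp add: P_def)
    moreover have "card P \<le> m * card F"
    proof -
      have "card P \<le> (\<Sum>k<m. card ((f' ^^ k) ` F))"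
        unfolding P_def by (intro card_UN_le) simp
      also have "\<dots> \<le> (\<Sum>k<m. card F)"
        by (intro sum_mono card_image_le F(1))
      finally show ?thesis by simp
    qed
    moreover have "\<exists>z\<in>P. \<forall>k<m. dist ((f ^^ k) x) ((f ^^ k) z) \<le> e" if x: "x \<in> X" for x
    proof -
      have "(f ^^ k) x \<in> X" for k
        using fk[of k] x by (auto simp: homeomorphism_def)
      then have "\<exists>V\<in>\<V>. (f ^^ k) x \<in> V" for k
        using \<V>(2) by (meson UnionE subsetD)
      then obtain V where V: "\<And>k. V k \<in> \<V>" "\<And>k. (f ^^ k) x \<in> V k" by metis
      define W where "W = (\<Inter>k<m. X \<inter> (f ^^ k) -` V k)"
      have contk: "continuous_map (top_of_set X) (top_of_set X) (f ^^ k)" for k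
        using fk[of k] by (auto simp: homeomorphism_def)
      have "openin (top_of_set X) (X \<inter> (f ^^ k) -` V k)" for k
        using openin_continuous_map_preimage[OF contk op[OF V(1)]]
        by (simp add: Collect_conj_eq vimage_def)
      then have opW: "openin (top_of_set X) W"
        unfolding W_def using m by (intro openin_INT2) (auto simp: lessThan_empty_iff)
      have xW: "x \<in> W" using V(2) x m by (auto simp: W_def lessThan_empty_iff)
      \<comment> \<open>Near points come from the closure of \<open>W\<close>: its frontier points lie outside \<open>W\<close> itself.\<close>
      have clos: "(f ^^ k) z \<in> (top_of_set X) closure_of V k"
        if "z \<in> (top_of_set X) closure_of W" "k < m" for z k
      proof -
        have "(f ^^ k) ` ((top_of_set X) closure_of W)
            \<subseteq> (top_of_set X) closure_of ((f ^^ k) ` W)"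
          using contk by (rule continuous_map_image_closure_subset)
        moreover have "(f ^^ k) ` W \<subseteq> V k" using that(2) by (auto simp: W_def)
        ultimately show ?thesis using that(1) closure_of_mono by blast
      qed
      have near: "\<forall>k<m. dist ((f ^^ k) x) ((f ^^ k) z) \<le> e"
        if "z \<in> (top_of_set X) closure_of W" for z
      proof (intro allI impI)
        fix k assume "k < m"
        from clos[OF that this] have "(f ^^ k) z \<in> closure (V k)"
          using closure_of_subtopology_subset[of euclidean X "V k"] by (auto simp: euclidean_closure_of)
        then show "dist ((f ^^ k) x) ((f ^^ k) z) \<le> e" using diam V by blast
      qed
      show ?thesis
      proof (cases "(top_of_set X) frontier_of W = {}")
        case True
        \<comment> \<open>Then \<open>W\<close> is clopen, hence the whole curve, and any point of \<open>P\<close> will do.\<close>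
        then have "W = X"
          using conn opW xW ne frontier_of_eq_empty[of W "top_of_set X"]
          unfolding connected_clopen by (metis empty_iff openin_imp_subset topspace_euclidean_subtopology)
        then have "x0 \<in> (top_of_set X) closure_of W"
          using x0 by (metis closure_of_topspace topspace_euclidean_subtopology)
        moreover have "x0 \<in> P" unfolding P_def using F(3) m by (intro UN_I[of 0]) auto
        ultimately show ?thesis using near by blast
      next
        case False
        then obtain z where z: "z \<in> (top_of_set X) closure_of W" "z \<notin> W" "z \<in> X"
          using opW by (auto simp: frontier_of_def interior_of_openin closure_of_def)
        then obtain k where k: "k < m" "(f ^^ k) z \<notin> V k" unfolding W_def by blast
        have "(f ^^ k) z \<in> (top_of_set X) frontier_of (V k)"
          using clos[OF z(1) k(1)] k(2) op[OF V(1)] by (simp add: frontier_of_def interior_of_openin)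
        then have "(f ^^ k) z \<in> F" using V(1) by (auto simp: F_def)
        moreover have "(f' ^^ k) ((f ^^ k) z) = z"
          using fk[of k] z(3) by (simp add: homeomorphism_def)
        \<comment> \<open>Invertibility of \<open>f\<close> makes \<open>z\<close> one of the at most \<open>m * card F\<close> preimages of \<open>F\<close>.\<close>
        ultimately have "z \<in> P" using k(1) unfolding P_def by force
        then show ?thesis using near z(1) by blast
      qed
    qed
    ultimately show "\<exists>P\<subseteq>X. finite P \<and> card P \<le> m * card F \<and>
       (\<forall>x\<in>X. \<exists>z\<in>P. \<forall>k<m. dist ((f ^^ k) x) ((f ^^ k) z) \<le> e)"
      by blast
  qed
qed

section \<open>The induced map on symmetric products\<close>

lemma hausdorff_dist_commute: "hausdorff_dist A B = hausdorff_dist B A"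
  by (simp add: hausdorff_dist_def max.commute)

lemma hausdorff_dist_le:
  assumes "A \<noteq> {}" "B \<noteq> {}"
    and "\<And>a. a \<in> A \<Longrightarrow> \<exists>b\<in>B. dist a b \<le> r" "\<And>b. b \<in> B \<Longrightarrow> \<exists>a\<in>A. dist a b \<le> r"
  shows "hausdorff_dist A B \<le> r"
  unfolding hausdorff_dist_def
proof (rule max.boundedI)
  show "(SUP a\<in>A. infdist a B) \<le> r"
    using assms(1,3) by (intro cSUP_least) (auto intro: infdist_le2)
  show "(SUP b\<in>B. infdist b A) \<le> r"
    using assms(2,4) by (intro cSUP_least) (auto intro: infdist_le2 simp: dist_commute)
qed

lemma hausdorff_dist_ge:
  assumes "finite A" "a \<in> A" "B \<noteq> {}" "\<And>b. b \<in> B \<Longrightarrow> r \<le> dist a b"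
  shows "r \<le> hausdorff_dist A B"
proof -
  have "r \<le> infdist a B"
    using assms(3,4) by (auto simp: infdist_def intro: cINF_greatest)
  also have "\<dots> \<le> (SUP a\<in>A. infdist a B)"
    using assms(1,2) by (intro cSUP_upper) auto
  finally show ?thesis by (simp add: hausdorff_dist_def)
qed

lemma funpow_induced_map: "(induced_map f ^^ k) A = (f ^^ k) ` A"
proof (induction k)
  case (Suc k)
  then show ?case by (auto simp: induced_map_def)
qed simp

text \<open>Every nonempty set with at most \<open>n\<close> elements is listed by a word of length exactly \<open>n\<close>.\<close>

lemma card_symmetric_product_le:
  assumes "finite P"
  shows "finite (symmetric_product n P)" "card (symmetric_product n P) \<le> card P ^ n"
proof -
  let ?L = "{xs. set xs \<subseteq> P \<and> length xs = n}"
  have sub: "symmetric_product n P \<subseteq> set ` ?L"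
  proof
    fix Q assume "Q \<in> symmetric_product n P"
    then have Q: "Q \<subseteq> P" "Q \<noteq> {}" "finite Q" "card Q \<le> n"
      by (auto simp: symmetric_product_def)
    obtain xs where xs: "set xs = Q" "distinct xs"
      using finite_distinct_list[OF Q(3)] by blast
    obtain q where "q \<in> Q" using Q(2) by blast
    then have "set (xs @ replicate (n - length xs) q) = Q"
      using xs(1) by (auto simp: set_replicate_conv_if)
    moreover have "length (xs @ replicate (n - length xs) q) = n"
      using Q(4) distinct_card[OF xs(2)] xs(1) by simp
    ultimately show "Q \<in> set ` ?L" using Q(1) by (metis (mono_tags, lifting) image_eqI mem_Collect_eq)
  qed
  have fin: "finite ?L" using assms by (rule finite_lists_length_eq)
  from sub fin show "finite (symmetric_product n P)" by (meson finite_surj)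
  have "card (symmetric_product n P) \<le> card ?L" using sub fin by (meson surj_card_le)
  then show "card (symmetric_product n P) \<le> card P ^ n"
    using assms by (simp add: card_lists_length_eq)
qed

text \<open>
  Moving each point to a spanning point close to it turns a finite subset of \<open>X\<close> into a subset
  of \<open>P\<close>, and two sets with the same result are at Bowen distance at most \<open>2 * e\<close>.
\<close>

lemma card_separated_symmetric_product_le:
  assumes span: "\<forall>x\<in>X. \<exists>z\<in>P. \<forall>k<m. dist ((f ^^ k) x) ((f ^^ k) z) \<le> e"
    and "finite P" "m \<ge> 1" "2 * e < \<epsilon>"
    and E: "separated_set (symmetric_product n X) hausdorff_dist (induced_map f) m \<epsilon> E"
  shows "card E \<le> card P ^ n"
proof -
  obtain \<pi> where \<pi>: "\<And>x. x \<in> X \<Longrightarrow> \<pi> x \<in> P"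
    "\<And>x k. x \<in> X \<Longrightarrow> k < m \<Longrightarrow> dist ((f ^^ k) x) ((f ^^ k) (\<pi> x)) \<le> e"
    using span by metis
  have EX: "A \<subseteq> X" "A \<noteq> {}" "finite A" "card A \<le> n" if "A \<in> E" for A
    using E that by (auto simp: separated_set_def symmetric_product_def)
  have near: "\<exists>b\<in>B. dist ((f ^^ k) a) ((f ^^ k) b) \<le> 2 * e"
    if "A \<subseteq> X" "B \<subseteq> X" "\<pi> ` A = \<pi> ` B" "k < m" "a \<in> A" for A B k a
  proof -
    have "\<pi> a \<in> \<pi> ` B" using that(3,5) by blast
    then obtain b where b: "b \<in> B" "\<pi> a = \<pi> b" by blast
    have "dist ((f ^^ k) a) ((f ^^ k) (\<pi> a)) \<le> e" "dist ((f ^^ k) b) ((f ^^ k) (\<pi> a)) \<le> e"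
      using \<pi>(2)[of a k] \<pi>(2)[of b k] b that by auto
    then have "dist ((f ^^ k) a) ((f ^^ k) b) \<le> 2 * e"
      using dist_triangle2[of "(f ^^ k) a" "(f ^^ k) b" "(f ^^ k) (\<pi> a)"] by simp
    with b(1) show ?thesis by blast
  qed
  have "inj_on (image \<pi>) E"
  proof (rule inj_onI, rule ccontr)
    fix A B assume AB: "A \<in> E" "B \<in> E" "\<pi> ` A = \<pi> ` B" "A \<noteq> B"
    have "bowen_dist hausdorff_dist (induced_map f) m A B \<le> 2 * e"
    proof (rule bowen_dist_le[OF \<open>m \<ge> 1\<close>], unfold funpow_induced_map, rule hausdorff_dist_le)
      fix k assume k: "k < m"
      show "(f ^^ k) ` A \<noteq> {}" "(f ^^ k) ` B \<noteq> {}" using EX AB by auto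
      show "\<exists>b\<in>(f ^^ k) ` B. dist a b \<le> 2 * e" if "a \<in> (f ^^ k) ` A" for a
        using near[OF EX(1)[OF AB(1)] EX(1)[OF AB(2)] AB(3) k] that by auto
      show "\<exists>a\<in>(f ^^ k) ` A. dist a b \<le> 2 * e" if "b \<in> (f ^^ k) ` B" for b
        using near[OF EX(1)[OF AB(2)] EX(1)[OF AB(1)] AB(3)[symmetric] k] that
        by (auto simp: dist_commute)
    qed
    moreover have "\<epsilon> \<le> bowen_dist hausdorff_dist (induced_map f) m A B"
      using E AB by (auto simp: separated_set_def)
    ultimately show False using \<open>2 * e < \<epsilon>\<close> by simp
  qed
  moreover have "image \<pi> ` E \<subseteq> symmetric_product n P"
  proof
    fix Q assume "Q \<in> image \<pi> ` E"
    then obtain A where A: "A \<in> E" "Q = \<pi> ` A" by blast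
    have "card Q \<le> n"
      using card_image_le[OF EX(3)[OF A(1)], of \<pi>] EX(4)[OF A(1)] A(2) by simp
    then show "Q \<in> symmetric_product n P"
      using EX[OF A(1)] A(2) \<pi>(1) by (auto simp: symmetric_product_def)
  qed
  ultimately have "card E \<le> card (symmetric_product n P)"
    using card_symmetric_product_le(1)[OF \<open>finite P\<close>] by (metis card_inj_on_le)
  also have "\<dots> \<le> card P ^ n" using card_symmetric_product_le(2)[OF \<open>finite P\<close>] .
  finally show ?thesis .
qed

section \<open>Separated families from a wandering point\<close>

text \<open>
  An orbit visits a wandering set at most once, and the orbit of \<open>f\<^bsup>-i\<^esup> p\<close> does so at time \<open>i\<close>.
  The two cases ask which of the visits at times \<open>i\<close> and \<open>j\<close> would come first.
\<close>

lemma wandering_backward_orbit_apart: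
  assumes f: "homeomorphism X X f f'" and U: "wandering_set f U" and p: "p \<in> U" "p \<in> X"
    and "i \<noteq> j"
  shows "(f ^^ j) ((f' ^^ i) p) \<notin> U" "(f ^^ j) ((f' ^^ i) p) \<in> X"
proof -
  have fk: "(f ^^ k) ((f' ^^ k) x) = x" "(f' ^^ k) x \<in> X" "(f ^^ k) x \<in> X" if "x \<in> X" for k x
    using homeomorphism_funpow[OF f, of k] that by (auto simp: homeomorphism_def)
  show "(f ^^ j) ((f' ^^ i) p) \<in> X" using fk p by simp
  show "(f ^^ j) ((f' ^^ i) p) \<notin> U"
  proof
    assume *: "(f ^^ j) ((f' ^^ i) p) \<in> U"
    show False
    proof (cases "i < j")
      case True
      have "f ^^ j = f ^^ (j - i) \<circ> f ^^ i"
        using True by (simp flip: funpow_add)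
      then have "(f ^^ (j - i)) p \<in> U" using * fk(1)[OF p(2), of i] by simp
      moreover have "j - i \<ge> 1" using True by simp
      ultimately show False using U p unfolding wandering_set_def by blast
    next
      case False
      with \<open>i \<noteq> j\<close> have ij: "i - j \<ge> 1" by simp
      have "f ^^ i = f ^^ (i - j) \<circ> f ^^ j"
        using ij by (simp flip: funpow_add)
      then have "(f ^^ (i - j)) ((f ^^ j) ((f' ^^ i) p)) \<in> U"
        using fk(1)[OF p(2), of i] p(1) by (metis comp_apply)
      with ij * U show False unfolding wandering_set_def by blast
    qed
  qed
qed

text \<open>
  Two different sets of the same size \<open>n\<close> of backward orbit points are told apart at the time
  at which a point in only one of them passes through \<open>p\<close>, because then the whole other set
  is at distance at least \<open>r\<close> from \<open>p\<close>.
\<close>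

lemma wandering_separated_family:
  fixes X :: "'a::metric_space set"
  assumes f: "homeomorphism X X f f'" and U: "wandering_set f U"
    and p: "p \<in> X" "X \<inter> ball p r \<subseteq> U" "r > 0"
    and "n \<ge> 1" "\<epsilon> \<le> r"
  shows "\<exists>E. separated_set (symmetric_product n X) hausdorff_dist (induced_map f) m \<epsilon> E
           \<and> card E = m choose n"
proof -
  define x where "x i = (f' ^^ i) p" for i
  have pU: "p \<in> U" using p by auto
  have home: "(f ^^ i) (x i) = p" "x i \<in> X" for i
    using homeomorphism_funpow[OF f, of i] p(1) by (auto simp: homeomorphism_def x_def)
  have away: "r \<le> dist p ((f ^^ j) (x i))" if "i \<noteq> j" for i j
    using wandering_backward_orbit_apart[OF f U pU p(1) that] p(2)
    by (fastforce simp: x_def)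
  have "inj x"
    using away home p(3) by (metis dist_self injI not_le)
  define \<S> where "\<S> = {S. S \<subseteq> {..<m} \<and> card S = n}"
  have S: "finite S" "S \<noteq> {}" "S \<subseteq> {..<m}" "card S = n" if "S \<in> \<S>" for S
    using that \<open>n \<ge> 1\<close> by (auto simp: \<S>_def intro: finite_subset)
  have ge: "\<epsilon> \<le> hausdorff_dist ((f ^^ j) ` x ` S) ((f ^^ j) ` x ` T)"
    if "finite S" "T \<noteq> {}" "j \<in> S" "j \<notin> T" for S T j
  proof (rule hausdorff_dist_ge)
    show "p \<in> (f ^^ j) ` x ` S" using that(3) home(1)[of j] by (metis imageI)
    fix b assume "b \<in> (f ^^ j) ` x ` T"
    then obtain i where "i \<in> T" "b = (f ^^ j) (x i)" by blast
    with away[of i j] that(4) \<open>\<epsilon> \<le> r\<close> show "\<epsilon> \<le> dist p b" by fastforce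
  qed (use that in auto)
  have "separated_set (symmetric_product n X) hausdorff_dist (induced_map f) m \<epsilon>
      (image x ` \<S>)"
    unfolding separated_set_def
  proof (intro conjI ballI impI)
    show "finite (image x ` \<S>)" by (simp add: \<S>_def)
    show "image x ` \<S> \<subseteq> symmetric_product n X"
    proof
      fix A assume "A \<in> image x ` \<S>"
      then obtain S where "S \<in> \<S>" "A = x ` S" by blast
      then show "A \<in> symmetric_product n X"
        using S[of S] home(2) card_image_le[of S x] by (auto simp: symmetric_product_def)
    qed
    fix A B assume "A \<in> image x ` \<S>" "B \<in> image x ` \<S>" "A \<noteq> B"
    then obtain S T where ST: "S \<in> \<S>" "T \<in> \<S>" "A = x ` S" "B = x ` T" "S \<noteq> T" by blast
    \<comment> \<open>Any index lying in only one of the two sets serves as the separating time.\<close>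
    then obtain j where j: "j \<in> S \<and> j \<notin> T \<or> j \<in> T \<and> j \<notin> S" by blast
    then have "j < m" using S(3) ST by blast
    moreover have "\<epsilon> \<le> hausdorff_dist ((f ^^ j) ` A) ((f ^^ j) ` B)"
      using j ge[of S T j] ge[of T S j] S ST hausdorff_dist_commute by metis
    ultimately show "\<epsilon> \<le> bowen_dist hausdorff_dist (induced_map f) m A B"
      by (intro bowen_dist_ge[of j]) (simp_all add: funpow_induced_map)
  qed
  moreover have "card (image x ` \<S>) = m choose n"
  proof -
    have "card (image x ` \<S>) = card \<S>"
      using \<open>inj x\<close> by (intro card_image) (meson inj_image_eq_iff inj_onI)
    then show ?thesis by (simp add: \<S>_def n_subsets)
  qed
  ultimately show ?thesis by blast
qed

section \<open>Polynomial entropy of the induced map\<close>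

theorem corollary9:
  fixes X :: "'a::metric_space set" and f f' :: "'a \<Rightarrow> 'a" and n :: nat
  assumes "regular_curve X"
    and "homeomorphism X X f f'"
    and "\<exists>p\<in>X. wandering_point X f p"
    and "n \<ge> 1"
  shows "h_pol (symmetric_product n X) hausdorff_dist (induced_map f) = ereal (real n)"
proof -
  let ?sep = "sep (symmetric_product n X) hausdorff_dist (induced_map f)"
  obtain p U W where "p \<in> X" "openin (top_of_set X) W" "p \<in> W" "W \<subseteq> U" and U: "wandering_set f U"
    using assms(3) unfolding wandering_point_def by blast
  then obtain r where r: "r > 0" "X \<inter> ball p r \<subseteq> U"
    unfolding openin_contains_ball by (metis inf_commute subset_trans)
  have lim: "limsup (\<lambda>m. ereal (ln (real (?sep m \<epsilon>)) / ln (real m))) = ereal (real n)"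
    if \<epsilon>: "0 < \<epsilon>" "\<epsilon> < r" for \<epsilon>
  proof -
    \<comment> \<open>Any spanning scale below \<open>\<epsilon> / 2\<close> works, since sets with the same approximation by
      spanning points are within twice that scale.\<close>
    obtain N where N: "N \<ge> 1" and span: "\<And>m. m \<ge> 1 \<Longrightarrow> \<exists>P\<subseteq>X. finite P \<and> card P \<le> m * N \<and>
       (\<forall>x\<in>X. \<exists>z\<in>P. \<forall>k<m. dist ((f ^^ k) x) ((f ^^ k) z) \<le> \<epsilon> / 3)"
      using regular_curve_linear_spanning[OF assms(1,2), of "\<epsilon> / 3"] \<epsilon>(1) by auto
    have bound: "card E \<le> (m * N) ^ n" if m: "m \<ge> 1"
      and E: "separated_set (symmetric_product n X) hausdorff_dist (induced_map f) m \<epsilon> E" for m E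
    proof -
      obtain P where P: "finite P" "card P \<le> m * N"
        "\<forall>x\<in>X. \<exists>z\<in>P. \<forall>k<m. dist ((f ^^ k) x) ((f ^^ k) z) \<le> \<epsilon> / 3"
        using span[OF m] by blast
      have "card E \<le> card P ^ n"
        using card_separated_symmetric_product_le[OF P(3,1) m _ E] \<epsilon>(1) by simp
      also have "\<dots> \<le> (m * N) ^ n" using P(2) by (rule power_mono) simp
      finally show ?thesis .
    qed
    have "(\<lambda>m. ln (real (?sep m \<epsilon>)) / ln (real m)) \<longlonglongrightarrow> real n"
    proof (rule tendsto_growth_exponent[OF assms(4) N])
      fix m assume m: "m \<ge> n"
      then have m1: "m \<ge> 1" using assms(4) by simp
      obtain E where "separated_set (symmetric_product n X) hausdorff_dist (induced_map f) m \<epsilon> E"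
        and E: "card E = m choose n"
        using wandering_separated_family[OF assms(2) U \<open>p \<in> X\<close> r(2,1) assms(4), of \<epsilon> m] \<epsilon>(2)
        by auto
      then have "m choose n \<le> ?sep m \<epsilon>"
        using sep_bounds(2)[OF bound[OF m1]] by metis
      with binomial_ge_n_over_k_pow_k[OF m, where ?'a = real]
      show "(real m / real n) ^ n \<le> real (?sep m \<epsilon>)" by linarith
    next
      fix m :: nat assume "m \<ge> 1"
      then show "?sep m \<epsilon> \<le> (m * N) ^ n" by (intro sep_bounds(1) bound)
    qed
    then show ?thesis by (intro lim_imp_Limsup) auto
  qed
  have "\<forall>\<^sub>F \<epsilon> in at_right 0.
      limsup (\<lambda>m. ereal (ln (real (?sep m \<epsilon>)) / ln (real m))) = ereal (real n)"
    using lim r(1) by (auto simp: eventually_at_right_field)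
  then show ?thesis
    unfolding h_pol_def by (intro tendsto_Lim tendsto_eventually) auto
qed

end
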